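(* Let $r_1,r_2,\rho_1,\rho_2$ be real numbers such that $r_1+r_2-\rho_1-\rho_2\notin\{1,2,3,\dots\}$, $r_1+r_2\notin\{1,2,3,\dots\}$, and $\tfrac12+\rho_i-r_1\notin\{0,-1,-2,\dots\}$ for $i=1,2$. Let $P_n$ be the monic polynomial eigenfunctions of the Dunkl shift operator $L$ defined in the context, and put $g=\rho_1+\rho_2-r_1-r_2$. Then for every $n$ there is a nonzero constant $A_{n0}$ (determined by the requirement that $P_n$ be monic) such that: (i) if $n$ is even, $$\frac{P_n(x)}{A_{n0}}={}_4F_3\!\left({-\frac n2,\ \frac n2+1+g,\ x-r_1+\frac12,\ -x-r_1+\frac12\atop 1-r_1-r_2,\ \frac12+\rho_1-r_1,\ \frac12+\rho_2-r_1};1\right)+\xi_n\,(x-r_1+\tfrac12)\;{}_4F_3\!\left({1-\frac n2,\ \frac n2+1+g,\ x-r_1+\frac32,\ -x-r_1+\frac12\atop 1-r_1-r_2,\ \frac32+\rho_1-r_1,\ \frac32+\rho_2-r_1};1\right),$$ where $\xi_n=\dfrac{n}{2(\frac12+\rho_1-r_1)(\frac12+\rho_2-r_1)}$ (the second term being absent for $n=0$); (ii) if $n$ is odd, $$\frac{P_n(x)}{A_{n0}}={}_4F_3\!\left({-\frac{n-1}2,\ \frac{n+1}2+g,\ x-r_1+\frac12,\ -x-r_1+\frac12\atop 1-r_1-r_2,\ \frac12+\rho_1-r_1,\ \frac12+\rho_2-r_1};1\right)-\eta_n\,(x-r_1+\tfrac12)\;{}_4F_3\!\left({-\frac{n-1}2,\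 \frac{n+3}2+g,\ x-r_1+\frac32,\ -x-r_1+\frac12\atop 1-r_1-r_2,\ \frac32+\rho_1-r_1,\ \frac32+\rho_2-r_1};1\right),$$ where $\eta_n=\dfrac{\frac{n+1}{2}+g}{(\frac12+\rho_1-r_1)(\frac12+\rho_2-r_1)}$.
   Context: For real parameters $r_1,r_2,\rho_1,\rho_2$ the Dunkl shift operator $L$ acts on polynomials by $$Lf(x)=\frac{(x-\rho_1)(x-\rho_2)}{2x}(f(x)-f(-x))+\frac{(x-r_1+1/2)(x-r_2+1/2)}{2x+1}(f(-x-1)-f(x)).$$ It maps polynomials to polynomials and $Lx^n=\lambda_nx^n+O(x^{n-1})$ with $\lambda_n=n/2$ for even $n$ and $\lambda_n=r_1+r_2-\rho_1-\rho_2-(n+1)/2$ for odd $n$. If $r_1+r_2-\rho_1-\rho_2\notin\{1,2,\dots\}$, the $\lambda_n$ are pairwise distinct, and $P_n$ denotes the unique monic polynomial of degree $n$ with $LP_n=\lambda_nP_n$. ${}_4F_3$ is the generalized hypergeometric series ${}_4F_3\left({a_1,\dots,a_4\atop b_1,b_2,b_3};1\right)=\sum_{k\ge0}\frac{(a_1)_k\cdots(a_4)_k}{(b_1)_k(b_2)_k(b_3)_k\,k!}$, which terminates here because one upper parameter is a nonpositive integer; $(a)_k=a(a+1)\cdots(a+k-1)$. *)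

theory Defs
  imports "HOL-Analysis.Analysis" "HOL-Computational_Algebra.Polynomial"
begin

definition dunkl_expr :: "real \<Rightarrow> real \<Rightarrow> real \<Rightarrow> real \<Rightarrow> (real \<Rightarrow> real) \<Rightarrow> real \<Rightarrow> real" where
  "dunkl_expr r1 r2 \<rho>1 \<rho>2 f x =
     (x - \<rho>1) * (x - \<rho>2) / (2 * x) * (f x - f (- x))
     + (x - r1 + 1/2) * (x - r2 + 1/2) / (2 * x + 1) * (f (- x - 1) - f x)"

(* The singularities of the defining expression at 0 and -1/2 are removable, so L p is the
   polynomial that agrees with the expression away from these two points; see dunkl_shift_poly
   for existence and dunkl_shift_unique for uniqueness. *)
definition dunkl_shift :: "real \<Rightarrow> real \<Rightarrow> real \<Rightarrow> real \<Rightarrow> real poly \<Rightarrow> real poly" where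
  "dunkl_shift r1 r2 \<rho>1 \<rho>2 p =
     (THE q. \<forall>x. x \<noteq> 0 \<longrightarrow> x \<noteq> - 1/2 \<longrightarrow> poly q x = dunkl_expr r1 r2 \<rho>1 \<rho>2 (poly p) x)"

lemma poly_eq_off_finite:
  fixes p q :: "real poly"
  assumes "finite S" and eq: "\<And>x. x \<notin> S \<Longrightarrow> poly p x = poly q x"
  shows "p = q"
proof (rule ccontr)
  assume "p \<noteq> q"
  then have "finite {x. poly (p - q) x = 0}"
    by (intro poly_roots_finite) simp
  moreover have "- S \<subseteq> {x. poly (p - q) x = 0}"
    using eq by auto
  ultimately have "finite (- S)"
    using finite_subset by blast
  then show False
    using \<open>finite S\<close> infinite_UNIV_char_0[where 'a = real] by (simp add: finite_compl)
qed

lemma dunkl_shift_exists: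
  "\<exists>q. \<forall>x. x \<noteq> 0 \<longrightarrow> x \<noteq> - 1/2 \<longrightarrow> poly q x = dunkl_expr r1 r2 \<rho>1 \<rho>2 (poly p) x"
proof -
  have "poly (p - pcompose p [:0, -1:]) 0 = 0"
    by (simp add: poly_pcompose)
  then obtain a where a: "p - pcompose p [:0, -1:] = [:- 0, 1:] * a"
    unfolding poly_eq_0_iff_dvd by (elim dvdE)
  have "poly (pcompose p [:-1, -1:] - p) (- 1/2) = 0"
    by (simp add: poly_pcompose)
  then obtain b where b: "pcompose p [:-1, -1:] - p = [:- (- 1/2), 1:] * b"
    unfolding poly_eq_0_iff_dvd by (elim dvdE)
  define q where "q = smult (1/2) ([:-\<rho>1, 1:] * [:-\<rho>2, 1:] * a)
                      + smult (1/2) ([:1/2 - r1, 1:] * [:1/2 - r2, 1:] * b)"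
  have "poly q x = dunkl_expr r1 r2 \<rho>1 \<rho>2 (poly p) x" if "x \<noteq> 0" "x \<noteq> - 1/2" for x
  proof -
    have 1: "poly p x - poly p (- x) = x * poly a x"
      using arg_cong[OF a, of "\<lambda>u. poly u x"] by (simp add: poly_pcompose)
    have 2: "poly p (- x - 1) - poly p x = (x + 1/2) * poly b x"
    proof -
      have "poly p (- 1 - x) - poly p x = (x + 1/2) * poly b x"
        using arg_cong[OF b, of "\<lambda>u. poly u x"] by (simp add: poly_pcompose distrib_right)
      moreover have "- x - 1 = - 1 - x" by simp
      ultimately show ?thesis by metis
    qed
    have 3: "(x - \<rho>1) * (x - \<rho>2) / (2 * x) * (x * poly a x)
             = 1/2 * ((x - \<rho>1) * (x - \<rho>2) * poly a x)"
      using that by simp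
    have nz: "2 * x + 1 \<noteq> 0" using that by linarith
    have half: "x + 1/2 = (2 * x + 1) * (1/2)" by simp
    have 4: "C / (2 * x + 1) * ((x + 1/2) * poly b x) = 1/2 * (C * poly b x)" for C
      unfolding half using nz by (simp del: distrib_right_numeral)
    show ?thesis
      unfolding dunkl_expr_def 1 2 3 4 by (simp add: q_def algebra_simps)
  qed
  then show ?thesis by blast
qed

lemma dunkl_shift_unique:
  assumes "\<And>x. x \<noteq> 0 \<Longrightarrow> x \<noteq> - 1/2 \<Longrightarrow> poly q x = dunkl_expr r1 r2 \<rho>1 \<rho>2 (poly p) x"
  shows "dunkl_shift r1 r2 \<rho>1 \<rho>2 p = q"
  unfolding dunkl_shift_def
proof (rule the_equality)
  show "\<forall>x. x \<noteq> 0 \<longrightarrow> x \<noteq> - 1/2 \<longrightarrow> poly q x = dunkl_expr r1 r2 \<rho>1 \<rho>2 (poly p) x"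
    using assms by blast
next
  fix q' assume "\<forall>x. x \<noteq> 0 \<longrightarrow> x \<noteq> - 1/2 \<longrightarrow> poly q' x = dunkl_expr r1 r2 \<rho>1 \<rho>2 (poly p) x"
  then show "q' = q"
    using assms by (intro poly_eq_off_finite[of "{0, - 1/2}"]) auto
qed

lemma dunkl_shift_poly:
  assumes "x \<noteq> 0" "x \<noteq> - 1/2"
  shows "poly (dunkl_shift r1 r2 \<rho>1 \<rho>2 p) x = dunkl_expr r1 r2 \<rho>1 \<rho>2 (poly p) x"
  using dunkl_shift_exists[of r1 r2 \<rho>1 \<rho>2 p] dunkl_shift_unique[of _ r1 r2 \<rho>1 \<rho>2 p] assms
  by metis

definition dunkl_eigval :: "real \<Rightarrow> real \<Rightarrow> real \<Rightarrow> real \<Rightarrow> nat \<Rightarrow> real" where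
  "dunkl_eigval r1 r2 \<rho>1 \<rho>2 n =
     (if even n then real n / 2 else r1 + r2 - \<rho>1 - \<rho>2 - (real n + 1) / 2)"

(* Unique when r1 + r2 - \<rho>1 - \<rho>2 is not a positive integer, since L is triangular in the
   monomial basis with the pairwise distinct diagonal entries dunkl_eigval. *)
definition dunkl_eigpoly :: "real \<Rightarrow> real \<Rightarrow> real \<Rightarrow> real \<Rightarrow> nat \<Rightarrow> real poly" where
  "dunkl_eigpoly r1 r2 \<rho>1 \<rho>2 n =
     (THE p. degree p = n \<and> lead_coeff p = 1 \<and>
        dunkl_shift r1 r2 \<rho>1 \<rho>2 p = smult (dunkl_eigval r1 r2 \<rho>1 \<rho>2 n) p)"

(* The series at argument 1; to be used only when it terminates and no lower parameter is a
   nonpositive integer. *)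
definition hyp4F3 ::
  "real \<Rightarrow> real \<Rightarrow> real \<Rightarrow> real \<Rightarrow> real \<Rightarrow> real \<Rightarrow> real \<Rightarrow> real" where
  "hyp4F3 a1 a2 a3 a4 b1 b2 b3 =
     (\<Sum>k. (pochhammer a1 k * pochhammer a2 k * pochhammer a3 k * pochhammer a4 k)
          / (pochhammer b1 k * pochhammer b2 k * pochhammer b3 k * fact k))"

end

theory Submission
  imports Defs
begin

text \<open>
  The reason behind the formula is that the operator \<open>L\<close> becomes bidiagonal in the basis obtained by
  multiplying up, alternately, the linear factors \<open>x + a + k\<close> and \<open>-x + a + k\<close> with
  \<open>a = 1/2 - r1\<close>: writing \<open>f n\<close> for the product of the first \<open>n\<close> factors, \<open>\<lambda>\<close> for the eigenvalues
  and \<open>\<nu>\<close> for \<open>offdiag\<close>, \<open>L (f n) = \<lambda> n * f n + \<nu> n * f (n - 1)\<close> (lemma \<open>dunkl_shift_alt_basis\<close>).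
  The two reflections in \<open>L\<close> are responsible for this. Since \<open>f (2 * k)\<close> is even, the part
  of \<open>L\<close> with the reflection \<open>x \<mapsto> -x\<close> kills it. The reflection \<open>x \<mapsto> -x - 1\<close> shifts the two
  groups of factors by one in opposite directions, so that one factor \<open>x + a\<close> gets lost; but \<open>x + a\<close>
  is also one of the coefficients in \<open>L\<close>, which repairs this.

  For a bidiagonal operator with distinct diagonal entries the eigenvector belonging to \<open>\<lambda> n\<close> is
  found by solving a two-term recurrence: its coordinates are the products of
  \<open>(\<lambda> n - \<lambda> i) / \<nu> (i + 1)\<close>. The hypotheses on the parameters say that all \<open>\<nu> (i + 1)\<close> are
  nonzero and that the \<open>\<lambda> i\<close> are distinct. Taking the recurrence two steps at a time turns the
  products into quotients of Pochhammer symbols. Hence the coordinates at even indices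
  sum to the first hypergeometric series, those at odd indices to the second
  (lemma \<open>eigvec_poly_eq_hyp4F3\<close>). Distinctness of the \<open>\<lambda> i\<close> together with
  triangularity of \<open>L\<close> also shows that a monic eigenpolynomial is unique
  (lemma \<open>dunkl_eigpoly_eqI\<close>), so that the vector found, once normalised, is \<open>P\<^sub>n\<close>.
\<close>

section \<open>A polynomial basis adapted to the two reflections\<close>

primrec alt_basis :: "real \<Rightarrow> nat \<Rightarrow> real poly" where
  "alt_basis a 0 = 1"
| "alt_basis a (Suc n) =
     alt_basis a n * [:a + real (n div 2), if even n then 1 else - 1:]"

lemma alt_basis_neq_0: "alt_basis a n \<noteq> 0"
  by (induction n) (simp_all del: mult_pCons_right)

lemma degree_alt_basis: "degree (alt_basis a n) = n"
proof (induction n)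
  case (Suc n)
  then show ?case
    by (simp add: degree_mult_eq alt_basis_neq_0 del: mult_pCons_right)
qed simp

lemma poly_alt_basis_even:
  "poly (alt_basis a (2 * k)) x = pochhammer (x + a) k * pochhammer (- x + a) k"
proof (induction k)
  case (Suc k)
  have "poly (alt_basis a (2 * Suc k)) x
      = poly (alt_basis a (2 * k)) x * (a + real k + x) * (a + real k - x)"
    by (simp del: mult_pCons_right)
  then show ?case
    unfolding Suc.IH by (simp add: pochhammer_Suc algebra_simps)
qed simp

lemma poly_alt_basis_odd:
  "poly (alt_basis a (Suc (2 * k))) x = pochhammer (x + a) (Suc k) * pochhammer (- x + a) k"
  unfolding alt_basis.simps poly_mult poly_alt_basis_even
  by (simp add: pochhammer_Suc algebra_simps)

lemma degree_less_alt_basis_reduce: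
  assumes "\<And>i. i \<ge> Suc n \<Longrightarrow> coeff p i = 0"
  obtains q where "p = smult (coeff p n / lead_coeff (alt_basis a n)) (alt_basis a n) + q"
    and "\<And>i. i \<ge> n \<Longrightarrow> coeff q i = 0"
proof
  let ?s = "coeff p n / lead_coeff (alt_basis a n)"
  let ?q = "p - smult ?s (alt_basis a n)"
  show "p = smult ?s (alt_basis a n) + ?q"
    by simp
  show "coeff ?q i = 0" if "i \<ge> n" for i
  proof (cases "i = n")
    case True
    then show ?thesis
      using alt_basis_neq_0[of a n] by (simp add: degree_alt_basis leading_coeff_0_iff[symmetric])
  next
    case False
    then show ?thesis
      using that assms[of i] by (simp add: coeff_eq_0 degree_alt_basis)
  qed
qed


section \<open>The Dunkl shift operator is bidiagonal\<close>

context
  fixes r1 r2 \<rho>1 \<rho>2 :: real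
begin

abbreviation L :: "real poly \<Rightarrow> real poly" where
  "L \<equiv> dunkl_shift r1 r2 \<rho>1 \<rho>2"

abbreviation eigval :: "nat \<Rightarrow> real" where
  "eigval \<equiv> dunkl_eigval r1 r2 \<rho>1 \<rho>2"

abbreviation basis :: "nat \<Rightarrow> real poly" where
  "basis \<equiv> alt_basis (1/2 - r1)"

definition offdiag :: "nat \<Rightarrow> real" where
  "offdiag n = (let k = real (n div 2) in
     if even n then - k * (k - r1 - r2) else (1/2 + \<rho>1 - r1 + k) * (1/2 + \<rho>2 - r1 + k))"

lemma dunkl_shift_add: "L (p + q) = L p + L q"
proof (rule dunkl_shift_unique)
  fix x :: real assume x: "x \<noteq> 0" "x \<noteq> - 1/2"
  have "C * (s - t) + D * (u - s) + (C * (s' - t') + D * (u' - s'))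
      = C * (s + s' - (t + t')) + D * (u + u' - (s + s'))" for C D s s' t t' u u' :: real
    by (simp add: algebra_simps)
  then show "poly (L p + L q) x = dunkl_expr r1 r2 \<rho>1 \<rho>2 (poly (p + q)) x"
    by (simp only: poly_add dunkl_shift_poly[OF x] dunkl_expr_def)
qed

lemma dunkl_shift_smult: "L (smult c p) = smult c (L p)"
proof (rule dunkl_shift_unique)
  fix x :: real assume x: "x \<noteq> 0" "x \<noteq> - 1/2"
  have "c * (C * (s - t) + D * (u - s)) = C * (c * s - c * t) + D * (c * u - c * s)"
    for C D s t u :: real
    by (simp add: algebra_simps)
  then show "poly (smult c (L p)) x = dunkl_expr r1 r2 \<rho>1 \<rho>2 (poly (smult c p)) x"
    by (simp only: poly_smult dunkl_shift_poly[OF x] dunkl_expr_def)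
qed

lemma dunkl_shift_0: "L 0 = 0"
  using dunkl_shift_smult[of 0 0] by simp

lemma dunkl_shift_diff: "L (p - q) = L p - L q"
  using dunkl_shift_add[of p "smult (- 1) q"] by (simp only: dunkl_shift_smult) simp

lemma dunkl_shift_sum: "L (\<Sum>i\<in>I. p i) = (\<Sum>i\<in>I. L (p i))"
  by (induction I rule: infinite_finite_induct) (simp_all add: dunkl_shift_0 dunkl_shift_add)

lemma dunkl_shift_1: "L 1 = 0"
  by (rule dunkl_shift_unique) (simp add: dunkl_expr_def)

text \<open>
  Here \<open>f (2 * k)\<close> is even, so only the reflection \<open>x \<mapsto> -x - 1\<close> contributes. It turns
  \<open>(u)\<^sub>k (v)\<^sub>k\<close>, where \<open>u = x + a\<close> and \<open>v = -x + a\<close>, into \<open>(v - 1)\<^sub>k (u + 1)\<^sub>k\<close>. The difference of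
  the two has the common factor \<open>(u + 1)\<^sub>k\<^sub>-\<^sub>1 (v)\<^sub>k\<^sub>-\<^sub>1\<close> and the cofactor \<open>-k * (2 * x + 1)\<close>.
\<close>

lemma dunkl_shift_basis_even:
  "L (basis (2 * Suc l)) =
     smult (real (Suc l)) (basis (2 * Suc l)) +
     smult (- real (Suc l) * (real (Suc l) - r1 - r2)) (basis (Suc (2 * l)))"
proof (rule dunkl_shift_unique)
  fix x :: real assume x: "x \<noteq> 0" "x \<noteq> - 1/2"
  then have nz: "2 * x + 1 \<noteq> 0"
    by linarith
  define a u v where "a = 1/2 - r1" and "u = x + a" and "v = - x + a"
  define p q where "p = pochhammer (u + 1) l" and "q = pochhammer v l"
  let ?k = "real (Suc l)"
  have f: "poly (alt_basis a (2 * Suc l)) x = u * p * (q * (v + l))"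
    unfolding poly_alt_basis_even p_def q_def u_def v_def
    by (simp only: pochhammer_rec[of "x + a"] pochhammer_Suc[of "- x + a"])
  have f_even: "poly (alt_basis a (2 * Suc l)) (- x) = poly (alt_basis a (2 * Suc l)) x"
    unfolding poly_alt_basis_even by simp
  have shift: "- x - 1 + a = v - 1" "- (- x - 1) + a = u + 1"
    by (simp_all add: u_def v_def)
  have f_refl: "poly (alt_basis a (2 * Suc l)) (- x - 1) = (v - 1) * q * (p * (u + 1 + l))"
    unfolding poly_alt_basis_even shift pochhammer_rec[of "v - 1"] pochhammer_Suc[of "u + 1"]
    by (simp add: p_def q_def)
  have f_odd: "poly (alt_basis a (Suc (2 * l))) x = u * p * q"
    unfolding poly_alt_basis_odd pochhammer_rec by (simp add: p_def q_def u_def v_def)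
  have diff: "(v - 1) * q * (p * (u + 1 + l)) - u * p * (q * (v + l)) = (2 * x + 1) * (- ?k * p * q)"
    by (simp add: u_def v_def algebra_simps)
  have "dunkl_expr r1 r2 \<rho>1 \<rho>2 (poly (alt_basis a (2 * Suc l))) x
      = u * (x - r2 + 1/2) * (- ?k * p * q)"
    unfolding dunkl_expr_def f_even f_refl f diff using nz
    by (simp add: u_def a_def del: of_nat_Suc)
  also have "\<dots> = ?k * (u * p * (q * (v + l))) + (- ?k * (?k - r1 - r2)) * (u * p * q)"
    unfolding v_def a_def by (simp add: algebra_simps add_divide_distrib diff_divide_distrib)
  also have "\<dots> = poly (smult ?k (alt_basis a (2 * Suc l)) +
      smult (- ?k * (?k - r1 - r2)) (alt_basis a (Suc (2 * l)))) x"
    by (simp only: poly_add poly_smult f f_odd)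
  finally show "poly (smult ?k (basis (2 * Suc l)) +
      smult (- ?k * (?k - r1 - r2)) (basis (Suc (2 * l)))) x
      = dunkl_expr r1 r2 \<rho>1 \<rho>2 (poly (basis (2 * Suc l))) x"
    unfolding a_def by simp
qed

text \<open>
  Both reflections change a single linear factor of \<open>f (2 * k + 1) = (u)\<^sub>k\<^sub>+\<^sub>1 (v)\<^sub>k\<close>: the first
  difference is \<open>2 * x * f (2 * k)\<close> and \<open>u\<close> times the second is \<open>-(2 * x + 1) * f (2 * k + 1)\<close>.
  What remains is \<open>f (2 * k)\<close> times a linear polynomial in \<open>x\<close>, since the quadratic terms cancel;
  its value at the zero \<open>x = -a - k\<close> of the last factor of \<open>f (2 * k + 1)\<close> is the
  coefficient of \<open>f (2 * k)\<close>.
\<close>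

lemma dunkl_shift_basis_odd:
  "L (basis (Suc (2 * k))) =
     smult (r1 + r2 - \<rho>1 - \<rho>2 - real (Suc k)) (basis (Suc (2 * k))) +
     smult ((1/2 + \<rho>1 - r1 + real k) * (1/2 + \<rho>2 - r1 + real k)) (basis (2 * k))"
proof (rule dunkl_shift_unique)
  fix x :: real assume x: "x \<noteq> 0" "x \<noteq> - 1/2"
  then have nz: "2 * x + 1 \<noteq> 0"
    by linarith
  define a u v where "a = 1/2 - r1" and "u = x + a" and "v = - x + a"
  define p p' q where "p = pochhammer u k" and "p' = pochhammer (u + 1) k"
    and "q = pochhammer v k"
  have pp': "u * p' = p * (u + k)"
    unfolding p_def p'_def by (simp only: pochhammer_rec[symmetric] pochhammer_Suc)
  have f: "poly (alt_basis a (Suc (2 * k))) x = p * (u + k) * q"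
    unfolding poly_alt_basis_odd p_def q_def u_def v_def pochhammer_Suc ..
  have f_neg: "poly (alt_basis a (Suc (2 * k))) (- x) = q * (v + k) * p"
    unfolding poly_alt_basis_odd p_def q_def u_def v_def pochhammer_Suc by simp
  have shift: "- x - 1 + a = v - 1" "- (- x - 1) + a = u + 1"
    by (simp_all add: u_def v_def)
  have f_refl: "poly (alt_basis a (Suc (2 * k))) (- x - 1) = (v - 1) * q * p'"
    unfolding poly_alt_basis_odd shift pochhammer_rec by (simp add: p'_def q_def)
  have f_low: "poly (alt_basis a (2 * k)) x = p * q"
    unfolding poly_alt_basis_even by (simp add: p_def q_def u_def v_def)
  have diff1: "p * (u + k) * q - q * (v + k) * p = 2 * x * (p * q)"
    by (simp add: u_def v_def algebra_simps)
  have diff2: "(v - 1) * q * p' - p * (u + k) * q = (2 * x + 1) * (- p' * q)"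
    unfolding pp'[symmetric] by (simp add: u_def v_def algebra_simps)
  have "dunkl_expr r1 r2 \<rho>1 \<rho>2 (poly (alt_basis a (Suc (2 * k)))) x
      = (x - \<rho>1) * (x - \<rho>2) * (p * q) - (x - r2 + 1/2) * (u * p') * q"
    unfolding dunkl_expr_def f_neg f_refl f diff1 diff2 using x nz
    by (simp add: u_def a_def)
  also have "\<dots> = (r1 + r2 - \<rho>1 - \<rho>2 - real (Suc k)) * (p * (u + k) * q)
      + (1/2 + \<rho>1 - r1 + real k) * (1/2 + \<rho>2 - r1 + real k) * (p * q)"
    unfolding pp' unfolding u_def a_def
    by (simp add: algebra_simps add_divide_distrib diff_divide_distrib)
  also have "\<dots> = poly (smult (r1 + r2 - \<rho>1 - \<rho>2 - real (Suc k)) (alt_basis a (Suc (2 * k))) +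
     smult ((1/2 + \<rho>1 - r1 + real k) * (1/2 + \<rho>2 - r1 + real k)) (alt_basis a (2 * k))) x"
    by (simp only: poly_add poly_smult f f_low)
  finally show "poly (smult (r1 + r2 - \<rho>1 - \<rho>2 - real (Suc k)) (basis (Suc (2 * k))) +
     smult ((1/2 + \<rho>1 - r1 + real k) * (1/2 + \<rho>2 - r1 + real k)) (basis (2 * k))) x
     = dunkl_expr r1 r2 \<rho>1 \<rho>2 (poly (basis (Suc (2 * k)))) x"
    unfolding a_def by simp
qed

lemma dunkl_shift_basis_0: "L (basis 0) = smult (eigval 0) (basis 0)"
  by (simp add: dunkl_shift_1 dunkl_eigval_def)

lemma dunkl_shift_alt_basis:
  "L (basis (Suc n)) = smult (eigval (Suc n)) (basis (Suc n)) + smult (offdiag (Suc n)) (basis n)"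
proof (cases "even n")
  case True
  then obtain k where n: "n = 2 * k"
    by blast
  have "eigval (Suc n) = r1 + r2 - \<rho>1 - \<rho>2 - real (Suc k)"
    by (simp add: n dunkl_eigval_def field_simps)
  moreover have "offdiag (Suc n) = (1/2 + \<rho>1 - r1 + real k) * (1/2 + \<rho>2 - r1 + real k)"
    by (simp add: n offdiag_def Let_def)
  ultimately show ?thesis
    unfolding n using dunkl_shift_basis_odd[of k] by simp
next
  case False
  then obtain l where n: "n = Suc (2 * l)"
    using oddE[of n] by (metis Suc_eq_plus1)
  have "eigval (Suc n) = real (Suc l)"
    by (simp add: n dunkl_eigval_def field_simps)
  moreover have "offdiag (Suc n) = - real (Suc l) * (real (Suc l) - r1 - r2)"
    by (simp add: n offdiag_def Let_def algebra_simps)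
  moreover have "Suc n = 2 * Suc l"
    by (simp add: n)
  ultimately show ?thesis
    using dunkl_shift_basis_even[of l] by (simp only: n)
qed


section \<open>Uniqueness of monic eigenpolynomials\<close>

lemma coeff_dunkl_shift_basis:
  "i \<ge> n \<Longrightarrow> coeff (L (basis n)) i = eigval n * coeff (basis n) i"
  by (cases n)
     (simp_all add: dunkl_shift_basis_0 dunkl_shift_alt_basis coeff_eq_0 degree_alt_basis
       del: alt_basis.simps)

lemma dunkl_shift_degree_less:
  assumes "\<And>i. i \<ge> n \<Longrightarrow> coeff p i = 0" and "i \<ge> n"
  shows "coeff (L p) i = 0"
  using assms
proof (induction n arbitrary: p i)
  case 0
  then have "p = 0"
    by (intro poly_eqI) simp
  then show ?case
    by (simp add: dunkl_shift_0)
next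
  case (Suc n)
  obtain q where q: "p = smult (coeff p n / lead_coeff (basis n)) (basis n) + q"
    and q0: "\<And>i. i \<ge> n \<Longrightarrow> coeff q i = 0"
    using degree_less_alt_basis_reduce[of n p] Suc.prems(1) by blast
  have "coeff (L (basis n)) i = 0"
    using coeff_dunkl_shift_basis[of n i] Suc.prems(2) by (simp add: coeff_eq_0 degree_alt_basis)
  moreover have "coeff (L q) i = 0"
    using Suc.IH[OF q0] Suc.prems(2) by simp
  ultimately show ?case
    by (subst q) (simp add: dunkl_shift_add dunkl_shift_smult)
qed

lemma coeff_degree_dunkl_shift:
  "coeff (L p) (degree p) = eigval (degree p) * lead_coeff p"
proof -
  let ?n = "degree p"
  obtain q where q: "p = smult (lead_coeff p / lead_coeff (basis ?n)) (basis ?n) + q"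
    and q0: "\<And>i. i \<ge> ?n \<Longrightarrow> coeff q i = 0"
    using degree_less_alt_basis_reduce[of ?n p] by (metis Suc_le_lessD coeff_eq_0)
  have "L p = smult (lead_coeff p / lead_coeff (basis ?n)) (L (basis ?n)) + L q"
    using arg_cong[OF q, of L] by (simp only: dunkl_shift_add dunkl_shift_smult)
  moreover have "coeff (L q) ?n = 0"
    using dunkl_shift_degree_less[OF q0] by simp
  moreover have "lead_coeff (basis ?n) \<noteq> 0"
    by (simp add: alt_basis_neq_0)
  ultimately show ?thesis
    by (simp add: coeff_dunkl_shift_basis degree_alt_basis)
qed

lemma eigval_inj:
  assumes "\<And>m::nat. m \<ge> 1 \<Longrightarrow> r1 + r2 - \<rho>1 - \<rho>2 \<noteq> real m"
  shows "inj eigval"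
proof -
  have mixed: "eigval (2 * k) \<noteq> eigval (Suc (2 * l))" for k l
    using assms[of "k + l + 1"] by (auto simp: dunkl_eigval_def field_simps)
  show ?thesis
  proof (rule injI)
    fix i j assume eq: "eigval i = eigval j"
    show "i = j"
    proof (cases "even i = even j")
      case True
      then show ?thesis
        using eq by (auto simp: dunkl_eigval_def split: if_splits)
    next
      case False
      then show ?thesis
        using eq mixed by (metis dvd_def oddE Suc_eq_plus1)
    qed
  qed
qed

text \<open>
  The difference of two candidates has degree less than \<open>n\<close>, so if it did not vanish its leading
  coefficient would force \<open>eigval n = eigval d\<close> for its degree \<open>d\<close>.
\<close>

lemma dunkl_eigpoly_eqI:
  assumes inj: "inj eigval" and deg: "degree p = n" and monic: "lead_coeff p = 1"
    and eig: "L p = smult (eigval n) p"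
  shows "dunkl_eigpoly r1 r2 \<rho>1 \<rho>2 n = p"
  unfolding dunkl_eigpoly_def
proof (rule the_equality)
  show "degree p = n \<and> lead_coeff p = 1 \<and> L p = smult (eigval n) p"
    using assms by blast
next
  fix q assume q: "degree q = n \<and> lead_coeff q = 1 \<and> L q = smult (eigval n) q"
  show "q = p"
  proof (rule ccontr)
    assume "q \<noteq> p"
    then have d0: "lead_coeff (q - p) \<noteq> 0"
      by (intro leading_coeff_neq_0) simp
    have "L (q - p) = smult (eigval n) (q - p)"
      using q eig by (simp add: dunkl_shift_diff smult_diff_right)
    then have "eigval (degree (q - p)) = eigval n"
      using coeff_degree_dunkl_shift[of "q - p"] d0 by simp
    then have "degree (q - p) = n"
      using inj by (simp add: inj_eq)
    moreover have "coeff (q - p) n = 0"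
      using q deg monic by (metis coeff_diff diff_self)
    ultimately show False
      using d0 by metis
  qed
qed


section \<open>The eigenvectors of the bidiagonal operator\<close>

text \<open>
  The coefficients of \<open>f j\<close> in \<open>L p = \<lambda> p\<close> give \<open>(\<lambda> - \<lambda> j) * e j = \<nu> (j + 1) * e (j + 1)\<close> for the
  coordinates \<open>e\<close> of \<open>p\<close>; \<open>eigcoord\<close> is the solution with \<open>e 0 = 1\<close>, and the factor for
  \<open>i = n\<close> makes it end at \<open>j = n\<close>.
\<close>

definition eigcoord :: "nat \<Rightarrow> nat \<Rightarrow> real" where
  "eigcoord n j = (\<Prod>i<j. (eigval n - eigval i) / offdiag (Suc i))"

definition eigvec :: "nat \<Rightarrow> real poly" where
  "eigvec n = (\<Sum>j\<le>n. smult (eigcoord n j) (basis j))"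

lemma offdiag_neq_0:
  assumes "\<And>m::nat. m \<ge> 1 \<Longrightarrow> r1 + r2 \<noteq> real m"
    and "\<And>m::nat. 1/2 + \<rho>1 - r1 \<noteq> - real m"
    and "\<And>m::nat. 1/2 + \<rho>2 - r1 \<noteq> - real m"
  shows "offdiag (Suc n) \<noteq> 0"
  using assms(1)[of "Suc n div 2"] assms(2,3)[of "Suc n div 2"]
  by (auto simp: offdiag_def Let_def add_eq_0_iff elim!: oddE)

lemma dunkl_shift_eigvec:
  assumes nz: "\<And>i. offdiag (Suc i) \<noteq> 0"
  shows "L (eigvec n) = smult (eigval n) (eigvec n)"
proof -
  have step: "eigcoord n (Suc j) * offdiag (Suc j) = eigcoord n j * (eigval n - eigval j)" for j
    using nz[of j] by (simp add: eigcoord_def)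
  \<comment> \<open>The recurrence matches all coordinates except the last, where the truncation leaves a defect;
      the defect vanishes at \<open>N = n\<close>.\<close>
  have partial: "L (\<Sum>j\<le>N. smult (eigcoord n j) (basis j)) =
      smult (eigval n) (\<Sum>j\<le>N. smult (eigcoord n j) (basis j))
      - smult (eigcoord n N * (eigval n - eigval N)) (basis N)" for N
  proof (induction N)
    case 0
    show ?case
      by (simp add: dunkl_shift_smult dunkl_shift_basis_0 del: alt_basis.simps)
         (simp add: smult_diff_left[symmetric] algebra_simps del: alt_basis.simps)
  next
    case (Suc N)
    let ?S = "\<Sum>j\<le>N. smult (eigcoord n j) (basis j)"
    have "L (\<Sum>j\<le>Suc N. smult (eigcoord n j) (basis j)) =
        L ?S + smult (eigcoord n (Suc N)) (L (basis (Suc N)))"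
      by (simp add: dunkl_shift_add dunkl_shift_smult del: alt_basis.simps)
    also have "\<dots> = smult (eigval n) ?S
        + smult (eigcoord n (Suc N) * eigval (Suc N)) (basis (Suc N))"
      unfolding Suc.IH dunkl_shift_alt_basis step[symmetric]
      by (simp add: smult_add_right del: alt_basis.simps)
    finally show ?case
      by (simp add: smult_add_right smult_diff_left right_diff_distrib mult.commute
          del: alt_basis.simps)
  qed
  show ?thesis
    unfolding eigvec_def partial by simp
qed

lemma coeff_eigvec_top: "coeff (eigvec n) n = eigcoord n n * lead_coeff (basis n)"
proof -
  have "coeff (eigvec n) n = (\<Sum>j\<le>n. eigcoord n j * coeff (basis j) n)"
    by (simp add: eigvec_def coeff_sum)
  also have "\<dots> = (\<Sum>j\<in>{n}. eigcoord n j * coeff (basis j) n)"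
    by (rule sum.mono_neutral_right) (auto simp: coeff_eq_0 degree_alt_basis)
  finally show ?thesis
    by (simp add: degree_alt_basis)
qed

lemma degree_eigvec_le: "degree (eigvec n) \<le> n"
  unfolding eigvec_def
  by (rule degree_sum_le) (auto intro: order.trans[OF degree_smult_le] simp: degree_alt_basis)

lemma dunkl_eigpoly_eigvec:
  assumes inj: "inj eigval" and nz: "\<And>i. offdiag (Suc i) \<noteq> 0"
  obtains A where "A \<noteq> 0" and "dunkl_eigpoly r1 r2 \<rho>1 \<rho>2 n = smult A (eigvec n)"
proof
  let ?c = "coeff (eigvec n) n"
  have "eigcoord n n \<noteq> 0"
    using inj nz by (auto simp: eigcoord_def inj_eq)
  then have c: "?c \<noteq> 0"
    by (simp add: coeff_eigvec_top alt_basis_neq_0)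
  then have deg: "degree (eigvec n) = n"
    using degree_eigvec_le le_degree by (metis order_antisym)
  show "inverse ?c \<noteq> 0"
    using c by simp
  show "dunkl_eigpoly r1 r2 \<rho>1 \<rho>2 n = smult (inverse ?c) (eigvec n)"
    using c deg
    by (intro dunkl_eigpoly_eqI[OF inj])
       (simp_all add: dunkl_shift_smult dunkl_shift_eigvec[OF nz] mult.commute)
qed


section \<open>Hypergeometric form of the eigenvectors\<close>

lemma pochhammer_swap_ends:
  fixes y :: real
  shows "pochhammer y k * (y + real k) = y * pochhammer (y + 1) k"
  by (metis pochhammer_Suc pochhammer_rec)

lemma hyp4F3_terminating:
  assumes "pochhammer a1 N = 0"
  shows "hyp4F3 a1 a2 a3 a4 b1 b2 b3 =
    (\<Sum>k<N. (pochhammer a1 k * pochhammer a2 k * pochhammer a3 k * pochhammer a4 k)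
          / (pochhammer b1 k * pochhammer b2 k * pochhammer b3 k * fact k))"
  unfolding hyp4F3_def
  by (rule suminf_finite) (auto simp: not_less intro: pochhammer_eq_0_mono[OF assms])

text \<open>
  Two consecutive steps of the recurrence multiply the coordinate by a rational function of \<open>k\<close>
  that depends on \<open>n\<close> only through \<open>m = n div 2\<close>. When \<open>n\<close> passes from even to odd, the factors
  \<open>eigval n - eigval (2 * k)\<close> and \<open>eigval n - eigval (2 * k + 1)\<close> are interchanged up to sign.
\<close>

lemma eigcoord_even:
  assumes g: "g = \<rho>1 + \<rho>2 - r1 - r2" and m: "m = n div 2"
  shows "eigcoord n (2 * k) =
    pochhammer (- real m) k * pochhammer (real m + 1 + g) k
    / (pochhammer (1 - r1 - r2) k * pochhammer (1/2 + \<rho>1 - r1) k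
       * pochhammer (1/2 + \<rho>2 - r1) k * fact k)"
proof (induction k)
  case 0
  show ?case by (simp add: eigcoord_def)
next
  case (Suc k)
  have vals: "eigval (2 * k) = real k" "eigval (Suc (2 * k)) = - g - 1 - real k"
    by (simp_all add: dunkl_eigval_def g field_simps)
  have num: "(eigval n - eigval (2 * k)) * (eigval n - eigval (Suc (2 * k)))
      = (real m - real k) * (real m + 1 + g + real k)"
  proof (cases "even n")
    case True
    then have e: "eigval n = real m"
      by (auto simp: m dunkl_eigval_def)
    then show ?thesis
      unfolding vals e by (simp add: algebra_simps)
  next
    case False
    then have e: "eigval n = - g - 1 - real m"
      by (auto simp: m g dunkl_eigval_def field_simps elim!: oddE)
    then show ?thesis
      unfolding vals e by (simp add: algebra_simps)
  qed
  have den: "offdiag (Suc (2 * k)) * offdiag (Suc (Suc (2 * k))) =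
      - (real (Suc k) * (1 - r1 - r2 + real k)
         * ((1/2 + \<rho>1 - r1 + real k) * (1/2 + \<rho>2 - r1 + real k)))"
    by (simp add: offdiag_def Let_def algebra_simps)
  have "eigcoord n (2 * Suc k) = eigcoord n (2 * k) *
      (((eigval n - eigval (2 * k)) * (eigval n - eigval (Suc (2 * k))))
       / (offdiag (Suc (2 * k)) * offdiag (Suc (Suc (2 * k)))))"
    by (simp add: eigcoord_def)
  also have "\<dots> = eigcoord n (2 * k) *
      ((- real m + real k) * (real m + 1 + g + real k)
       / (real (Suc k) * (1 - r1 - r2 + real k)
         * ((1/2 + \<rho>1 - r1 + real k) * (1/2 + \<rho>2 - r1 + real k))))"
    unfolding num den by (simp only: divide_minus_right minus_divide_left) (simp add: algebra_simps)
  finally show ?case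
    unfolding Suc.IH pochhammer_Suc fact_Suc times_divide_times_eq
    by (simp only: mult_ac)
qed

lemma eigcoord_odd:
  "eigcoord n (Suc (2 * k)) = eigcoord n (2 * k) *
     ((eigval n - real k) / ((1/2 + \<rho>1 - r1 + real k) * (1/2 + \<rho>2 - r1 + real k)))"
  by (simp add: eigcoord_def offdiag_def dunkl_eigval_def Let_def)

lemma eigcoord_eq_0: "n < j \<Longrightarrow> eigcoord n j = 0"
  unfolding eigcoord_def by (rule prod_zero) auto

text \<open>
  The coordinate just above \<open>n\<close> vanishes, so for even \<open>n\<close> the last pair may be completed.
\<close>

lemma poly_eigvec:
  assumes m: "m = n div 2"
  shows "poly (eigvec n) x =
    (\<Sum>k<Suc m. eigcoord n (2 * k)
       * (pochhammer (x - r1 + 1/2) k * pochhammer (- x - r1 + 1/2) k)) +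
    (\<Sum>k<Suc m. eigcoord n (Suc (2 * k))
       * (pochhammer (x - r1 + 1/2) (Suc k) * pochhammer (- x - r1 + 1/2) k))"
proof -
  define t where "t j = eigcoord n j * poly (basis j) x" for j
  have pairs: "(\<Sum>j<2 * N. t j) = (\<Sum>k<N. t (2 * k)) + (\<Sum>k<N. t (Suc (2 * k)))" for N
    by (induction N) simp_all
  have a: "x + (1/2 - r1) = x - r1 + 1/2" "- x + (1/2 - r1) = - x - r1 + 1/2"
    by simp_all
  have "poly (eigvec n) x = (\<Sum>j\<le>n. t j)"
    by (simp add: eigvec_def poly_sum t_def)
  also have "\<dots> = (\<Sum>j<2 * Suc m. t j)"
    by (rule sum.mono_neutral_left) (auto simp: m t_def intro!: eigcoord_eq_0)
  finally have "poly (eigvec n) x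
      = (\<Sum>k<Suc m. t (2 * k)) + (\<Sum>k<Suc m. t (Suc (2 * k)))"
    by (simp only: pairs)
  then show ?thesis
    by (simp only: t_def poly_alt_basis_even poly_alt_basis_odd a)
qed

text \<open>
  Both parities follow from one statement, in which \<open>s * (z)\<^sub>k * (w)\<^sub>k\<close> is what remains of the
  numerator after the factor \<open>eigval n - k\<close> has been absorbed into \<open>(- m)\<^sub>k\<close> (for even \<open>n\<close>)
  or into \<open>(m + 1 + g)\<^sub>k\<close> (for odd \<open>n\<close>).
\<close>

lemma eigvec_poly_eq_hyp4F3:
  assumes g: "g = \<rho>1 + \<rho>2 - r1 - r2" and m: "m = n div 2"
    and absorb: "\<And>k. pochhammer (- real m) k * pochhammer (real m + 1 + g) k
      * (eigval n - real k) = s * (pochhammer z k * pochhammer w k)"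
    and term_z: "pochhammer z (Suc m) = 0"
  shows "poly (eigvec n) x =
    hyp4F3 (- real m) (real m + 1 + g) (x - r1 + 1/2) (- x - r1 + 1/2)
      (1 - r1 - r2) (1/2 + \<rho>1 - r1) (1/2 + \<rho>2 - r1)
    + s / ((1/2 + \<rho>1 - r1) * (1/2 + \<rho>2 - r1)) * (x - r1 + 1/2) *
      hyp4F3 z w (x - r1 + 3/2) (- x - r1 + 1/2)
        (1 - r1 - r2) (3/2 + \<rho>1 - r1) (3/2 + \<rho>2 - r1)"
proof -
  define \<alpha> \<beta> c u v where "\<alpha> = 1/2 + \<rho>1 - r1" and "\<beta> = 1/2 + \<rho>2 - r1" and "c = 1 - r1 - r2"
    and "u = x - r1 + 1/2" and "v = - x - r1 + 1/2"
  have plus1: "3/2 + \<rho>1 - r1 = \<alpha> + 1" "3/2 + \<rho>2 - r1 = \<beta> + 1" "x - r1 + 3/2 = u + 1"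
    by (simp_all add: \<alpha>_def \<beta>_def u_def)
  have even: "eigcoord n (2 * k) * (pochhammer u k * pochhammer v k) =
      pochhammer (- real m) k * pochhammer (real m + 1 + g) k * pochhammer u k * pochhammer v k
      / (pochhammer c k * pochhammer \<alpha> k * pochhammer \<beta> k * fact k)" for k
    unfolding eigcoord_even[OF g m] \<alpha>_def \<beta>_def c_def by simp
  have odd: "eigcoord n (Suc (2 * k)) * (pochhammer u (Suc k) * pochhammer v k) =
      s / (\<alpha> * \<beta>) * u *
      (pochhammer z k * pochhammer w k * pochhammer (u + 1) k * pochhammer v k
       / (pochhammer c k * pochhammer (\<alpha> + 1) k * pochhammer (\<beta> + 1) k * fact k))" for k
  proof -
    have "eigcoord n (Suc (2 * k)) =
        pochhammer (- real m) k * pochhammer (real m + 1 + g) k * (eigval n - real k)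
        / (pochhammer c k * fact k * (pochhammer \<alpha> k * (\<alpha> + real k))
           * (pochhammer \<beta> k * (\<beta> + real k)))"
      unfolding eigcoord_odd eigcoord_even[OF g m] times_divide_times_eq \<alpha>_def \<beta>_def c_def
      by (simp only: mult_ac)
    also have "\<dots> = s * (pochhammer z k * pochhammer w k)
        / (pochhammer c k * fact k * (\<alpha> * pochhammer (\<alpha> + 1) k) * (\<beta> * pochhammer (\<beta> + 1) k))"
      unfolding absorb pochhammer_swap_ends ..
    finally show ?thesis
      unfolding pochhammer_rec by (simp only: times_divide_times_eq times_divide_eq_left
          times_divide_eq_right divide_divide_eq_left mult_ac)
  qed
  have term_m: "pochhammer (- real m) (Suc m) = 0"
    by (simp add: pochhammer_of_nat_eq_0_iff)
  show ?thesis
    unfolding poly_eigvec[OF m] hyp4F3_terminating[OF term_m] hyp4F3_terminating[OF term_z]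
      plus1 \<alpha>_def[symmetric] \<beta>_def[symmetric] c_def[symmetric] u_def[symmetric] v_def[symmetric]
      even odd sum_distrib_left ..
qed

end

theorem mainTheorem4:
  fixes r1 r2 \<rho>1 \<rho>2 g :: real and \<xi> \<eta> :: "nat \<Rightarrow> real"
  assumes "\<And>m::nat. m \<ge> 1 \<Longrightarrow> r1 + r2 - \<rho>1 - \<rho>2 \<noteq> real m"
    and "\<And>m::nat. m \<ge> 1 \<Longrightarrow> r1 + r2 \<noteq> real m"
    and "\<And>m::nat. 1/2 + \<rho>1 - r1 \<noteq> - real m"
    and "\<And>m::nat. 1/2 + \<rho>2 - r1 \<noteq> - real m"
    and "g = \<rho>1 + \<rho>2 - r1 - r2"
    and "\<And>n. \<xi> n = real n / (2 * (1/2 + \<rho>1 - r1) * (1/2 + \<rho>2 - r1))"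
    and "\<And>n. \<eta> n = ((real n + 1) / 2 + g) / ((1/2 + \<rho>1 - r1) * (1/2 + \<rho>2 - r1))"
  shows "\<forall>n::nat. \<exists>A::real. A \<noteq> 0 \<and>
    (even n \<longrightarrow> (\<forall>x::real.
       poly (dunkl_eigpoly r1 r2 \<rho>1 \<rho>2 n) x / A =
         hyp4F3 (- (real n / 2)) (real n / 2 + 1 + g) (x - r1 + 1/2) (- x - r1 + 1/2)
                (1 - r1 - r2) (1/2 + \<rho>1 - r1) (1/2 + \<rho>2 - r1)
         + (if n = 0 then 0 else
              \<xi> n * (x - r1 + 1/2) *
              hyp4F3 (1 - real n / 2) (real n / 2 + 1 + g) (x - r1 + 3/2) (- x - r1 + 1/2)
                     (1 - r1 - r2) (3/2 + \<rho>1 - r1) (3/2 + \<rho>2 - r1)))) \<and>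
    (odd n \<longrightarrow> (\<forall>x::real.
       poly (dunkl_eigpoly r1 r2 \<rho>1 \<rho>2 n) x / A =
         hyp4F3 (- ((real n - 1) / 2)) ((real n + 1) / 2 + g) (x - r1 + 1/2) (- x - r1 + 1/2)
                (1 - r1 - r2) (1/2 + \<rho>1 - r1) (1/2 + \<rho>2 - r1)
         - \<eta> n * (x - r1 + 1/2) *
           hyp4F3 (- ((real n - 1) / 2)) ((real n + 3) / 2 + g) (x - r1 + 3/2) (- x - r1 + 1/2)
                  (1 - r1 - r2) (3/2 + \<rho>1 - r1) (3/2 + \<rho>2 - r1)))"
proof
  fix n :: nat
  define m where "m = n div 2"
  define \<alpha>\<beta> where "\<alpha>\<beta> = (1/2 + \<rho>1 - r1) * (1/2 + \<rho>2 - r1)"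
  obtain A where A: "A \<noteq> 0"
    and P: "dunkl_eigpoly r1 r2 \<rho>1 \<rho>2 n = smult A (eigvec r1 r2 \<rho>1 \<rho>2 n)"
    using dunkl_eigpoly_eigvec[OF eigval_inj[OF assms(1)] offdiag_neq_0[OF assms(2-4)]] by metis
  have quot: "poly (dunkl_eigpoly r1 r2 \<rho>1 \<rho>2 n) x / A = poly (eigvec r1 r2 \<rho>1 \<rho>2 n) x" for x
    using A by (simp add: P)
  show "\<exists>A::real. A \<noteq> 0 \<and>
    (even n \<longrightarrow> (\<forall>x::real.
       poly (dunkl_eigpoly r1 r2 \<rho>1 \<rho>2 n) x / A =
         hyp4F3 (- (real n / 2)) (real n / 2 + 1 + g) (x - r1 + 1/2) (- x - r1 + 1/2)
                (1 - r1 - r2) (1/2 + \<rho>1 - r1) (1/2 + \<rho>2 - r1)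
         + (if n = 0 then 0 else
              \<xi> n * (x - r1 + 1/2) *
              hyp4F3 (1 - real n / 2) (real n / 2 + 1 + g) (x - r1 + 3/2) (- x - r1 + 1/2)
                     (1 - r1 - r2) (3/2 + \<rho>1 - r1) (3/2 + \<rho>2 - r1)))) \<and>
    (odd n \<longrightarrow> (\<forall>x::real.
       poly (dunkl_eigpoly r1 r2 \<rho>1 \<rho>2 n) x / A =
         hyp4F3 (- ((real n - 1) / 2)) ((real n + 1) / 2 + g) (x - r1 + 1/2) (- x - r1 + 1/2)
                (1 - r1 - r2) (1/2 + \<rho>1 - r1) (1/2 + \<rho>2 - r1)
         - \<eta> n * (x - r1 + 1/2) *
           hyp4F3 (- ((real n - 1) / 2)) ((real n + 3) / 2 + g) (x - r1 + 3/2) (- x - r1 + 1/2)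
                  (1 - r1 - r2) (3/2 + \<rho>1 - r1) (3/2 + \<rho>2 - r1)))"
  proof (intro exI[of _ A] conjI impI allI A)
    fix x :: real assume "even n"
    then have n: "real n / 2 = real m" and eig: "dunkl_eigval r1 r2 \<rho>1 \<rho>2 n = real m"
      by (auto simp: m_def dunkl_eigval_def)
    have absorb: "pochhammer (- real m) k * pochhammer (real m + 1 + g) k
        * (dunkl_eigval r1 r2 \<rho>1 \<rho>2 n - real k)
        = real m * (pochhammer (1 - real m) k * pochhammer (real m + 1 + g) k)" for k
    proof -
      have "pochhammer (- real m) k * pochhammer (real m + 1 + g) k
          * (dunkl_eigval r1 r2 \<rho>1 \<rho>2 n - real k)
          = - (pochhammer (- real m) k * (- real m + real k)) * pochhammer (real m + 1 + g) k"
        unfolding eig by (simp add: algebra_simps)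
      then show ?thesis
        unfolding pochhammer_swap_ends by simp
    qed
    have xi: "\<xi> n = real m / \<alpha>\<beta>"
      unfolding assms(6) \<alpha>\<beta>_def n[symmetric] by (simp add: mult.assoc)
    show "poly (dunkl_eigpoly r1 r2 \<rho>1 \<rho>2 n) x / A =
         hyp4F3 (- (real n / 2)) (real n / 2 + 1 + g) (x - r1 + 1/2) (- x - r1 + 1/2)
                (1 - r1 - r2) (1/2 + \<rho>1 - r1) (1/2 + \<rho>2 - r1)
         + (if n = 0 then 0 else
              \<xi> n * (x - r1 + 1/2) *
              hyp4F3 (1 - real n / 2) (real n / 2 + 1 + g) (x - r1 + 3/2) (- x - r1 + 1/2)
                     (1 - r1 - r2) (3/2 + \<rho>1 - r1) (3/2 + \<rho>2 - r1))"
    proof (cases "n = 0")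
      case True
      then have "m = 0"
        by (simp add: m_def)
      then have "poly (eigvec r1 r2 \<rho>1 \<rho>2 n) x =
          hyp4F3 (- real m) (real m + 1 + g) (x - r1 + 1/2) (- x - r1 + 1/2)
            (1 - r1 - r2) (1/2 + \<rho>1 - r1) (1/2 + \<rho>2 - r1)"
        \<comment> \<open>With \<open>z = 1 - m = 1\<close> the second series need not terminate. Its coefficient is \<open>0\<close>, so
            any \<open>z\<close> and \<open>w\<close> serve for which it does.\<close>
        by (subst eigvec_poly_eq_hyp4F3[OF assms(5) m_def, where s = 0 and z = 0 and w = 0])
           (simp_all add: eig pochhammer_0_left)
      then show ?thesis
        unfolding quot n using True by simp
    next
      case False
      then have "m \<ge> 1"
        using \<open>even n\<close> by (auto simp: m_def elim!: evenE)
      then have "pochhammer (1 - real m) (Suc m) = 0"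
        unfolding pochhammer_eq_0_iff by (intro exI[of _ "m - 1"]) (auto simp: of_nat_diff)
      from eigvec_poly_eq_hyp4F3[OF assms(5) m_def absorb this] show ?thesis
        unfolding quot n xi \<alpha>\<beta>_def using False by simp
    qed
  next
    fix x :: real assume "odd n"
    then have n: "real n = 2 * real m + 1"
      by (auto simp: m_def elim!: oddE)
    have args: "(real n - 1) / 2 = real m" "(real n + 1) / 2 + g = real m + 1 + g"
      "(real n + 3) / 2 + g = real m + 1 + g + 1"
      by (simp_all add: n field_simps)
    have eig: "dunkl_eigval r1 r2 \<rho>1 \<rho>2 n = - (real m + 1 + g)"
      using \<open>odd n\<close> by (simp add: dunkl_eigval_def assms(5) n field_simps)
    have absorb: "pochhammer (- real m) k * pochhammer (real m + 1 + g) k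
        * (dunkl_eigval r1 r2 \<rho>1 \<rho>2 n - real k)
        = - (real m + 1 + g) * (pochhammer (- real m) k * pochhammer (real m + 1 + g + 1) k)" for k
    proof -
      have "pochhammer (- real m) k * pochhammer (real m + 1 + g) k
          * (dunkl_eigval r1 r2 \<rho>1 \<rho>2 n - real k)
          = - pochhammer (- real m) k * (pochhammer (real m + 1 + g) k * (real m + 1 + g + real k))"
        unfolding eig by (simp add: algebra_simps)
      then show ?thesis
        unfolding pochhammer_swap_ends by (simp only: mult_minus_left mult_minus_right mult_ac)
    qed
    have "pochhammer (- real m) (Suc m) = 0"
      by (simp add: pochhammer_of_nat_eq_0_iff)
    from eigvec_poly_eq_hyp4F3[OF assms(5) m_def absorb this]
    show "poly (dunkl_eigpoly r1 r2 \<rho>1 \<rho>2 n) x / A =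
         hyp4F3 (- ((real n - 1) / 2)) ((real n + 1) / 2 + g) (x - r1 + 1/2) (- x - r1 + 1/2)
                (1 - r1 - r2) (1/2 + \<rho>1 - r1) (1/2 + \<rho>2 - r1)
         - \<eta> n * (x - r1 + 1/2) *
           hyp4F3 (- ((real n - 1) / 2)) ((real n + 3) / 2 + g) (x - r1 + 3/2) (- x - r1 + 1/2)
                  (1 - r1 - r2) (3/2 + \<rho>1 - r1) (3/2 + \<rho>2 - r1)"
      unfolding quot assms(7) args by (simp only: divide_minus_left mult_minus_left)
  qed
qed

end
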